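(* Let $G$ be a group and let $s$ be a positive integer. Then there exists a generalized quadrangle $\mathcal{Q}$ of order $s$ such that $G$ is a group of automorphisms of $\mathcal{Q}$ acting regularly on both the point set and the line set of $\mathcal{Q}$ if and only if $G$ contains a subset $\Sigma = \{g_0 = 1, g_1, g_2, \dots, g_s\}$ of $s+1$ distinct elements satisfying the following two conditions: \begin{itemize} \item[(AX1)] If $g \in G \setminus \Sigma$, then there exist unique integers $i,j,k \in \{0,1,\dots,s\}$ (with $i \neq j$ and $k \neq j$) such that $g = g_i g_j^{-1} g_k$. \item[(AX2)] For all $i,j,k \in \{0,1,\dots,s\}$, if $g_i g_j^{-1} g_k \in \Sigma$, then either $i = j$ or $j = k$. \end{itemize}
   Context: A finite generalized quadrangle $\mathcal{Q}$ is an incidence geometry consisting of a finite set $\mathcal{P}$ of points and a finite set $\mathcal{L}$ of lines such that any two distinct points are incident with at most one common line and, whenever a point $P$ is not incident with a line $\ell$, there is a unique point on $\ell$ collinear with $P$. It has order $(s,t)$, with $s,t$ positive integers, if every line is incident with exactly $s+1$ points and every point is incident with exactly $t+1$ lines; it has order $s$ if it has order $(s,s)$. An automorphism permutes the points and permutes the lines, preserving incidence. A group $G$ acts regularly on a set $\Omega$ if $G$ is transitive on $\Omega$ and every point stabilizer $G_\omega$ ($\omega\in\Omega$) is trivial. *)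

theory Defs
  imports "HOL-Algebra.Group_Action"
begin

text \<open>Only the values of \<open>incid\<close> on \<open>points Q \<times> lines Q\<close> matter below.\<close>

record ('p, 'l) incidence_geometry =
  points :: "'p set"
  lines :: "'l set"
  incid :: "'p \<Rightarrow> 'l \<Rightarrow> bool"

definition collinear :: "('p, 'l) incidence_geometry \<Rightarrow> 'p \<Rightarrow> 'p \<Rightarrow> bool" where
  "collinear Q p r \<longleftrightarrow> (\<exists>l\<in>lines Q. incid Q p l \<and> incid Q r l)"

definition generalized_quadrangle :: "('p, 'l) incidence_geometry \<Rightarrow> bool" where
  "generalized_quadrangle Q \<longleftrightarrow>
     finite (points Q) \<and> finite (lines Q) \<and>
     (\<forall>p\<in>points Q. \<forall>r\<in>points Q. p \<noteq> r \<longrightarrow>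
        (\<forall>l\<in>lines Q. \<forall>m\<in>lines Q.
           incid Q p l \<and> incid Q r l \<and> incid Q p m \<and> incid Q r m \<longrightarrow> l = m)) \<and>
     (\<forall>p\<in>points Q. \<forall>l\<in>lines Q. \<not> incid Q p l \<longrightarrow>
        (\<exists>!r. r \<in> points Q \<and> incid Q r l \<and> collinear Q p r))"

definition has_order :: "('p, 'l) incidence_geometry \<Rightarrow> nat \<Rightarrow> nat \<Rightarrow> bool" where
  "has_order Q s t \<longleftrightarrow>
     s > 0 \<and> t > 0 \<and>
     (\<forall>l\<in>lines Q. card {p \<in> points Q. incid Q p l} = s + 1) \<and>
     (\<forall>p\<in>points Q. card {l \<in> lines Q. incid Q p l} = t + 1)"

definition automorphism ::
    "('p, 'l) incidence_geometry \<Rightarrow> ('p \<Rightarrow> 'p) \<Rightarrow> ('l \<Rightarrow> 'l) \<Rightarrow> bool" where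
  "automorphism Q \<sigma> \<tau> \<longleftrightarrow>
     bij_betw \<sigma> (points Q) (points Q) \<and> bij_betw \<tau> (lines Q) (lines Q) \<and>
     (\<forall>p\<in>points Q. \<forall>l\<in>lines Q. incid Q (\<sigma> p) (\<tau> l) \<longleftrightarrow> incid Q p l)"

text \<open>\<open>G\<close> is identified with a group of automorphisms of \<open>Q\<close> by the injective homomorphism
  sending \<open>g\<close> to the pair of its permutations \<open>\<phi> g\<close> of the points and \<open>\<psi> g\<close> of the lines.\<close>

definition automorphism_group_via ::
    "('a, 'c) monoid_scheme \<Rightarrow> ('p, 'l) incidence_geometry
       \<Rightarrow> ('a \<Rightarrow> 'p \<Rightarrow> 'p) \<Rightarrow> ('a \<Rightarrow> 'l \<Rightarrow> 'l) \<Rightarrow> bool" where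
  "automorphism_group_via G Q \<phi> \<psi> \<longleftrightarrow>
     group_action G (points Q) \<phi> \<and> group_action G (lines Q) \<psi> \<and>
     (\<forall>g\<in>carrier G. automorphism Q (\<phi> g) (\<psi> g)) \<and>
     inj_on (\<lambda>g. (\<phi> g, \<psi> g)) (carrier G)"

text \<open>A transitive action has exactly one orbit, so the set acted on is nonempty. The locale
  \<open>transitive_action\<close> admits the empty set; without the extra condition the geometry with no
  points and no lines would be a generalized quadrangle of every order with a regular action.\<close>

definition acts_regularly ::
    "('a, 'c) monoid_scheme \<Rightarrow> 'b set \<Rightarrow> ('a \<Rightarrow> 'b \<Rightarrow> 'b) \<Rightarrow> bool" where
  "acts_regularly G E \<phi> \<longleftrightarrow>
     E \<noteq> {} \<and> transitive_action G E \<phi> \<and> (\<forall>x\<in>E. stabilizer G \<phi> x = {\<one>\<^bsub>G\<^esub>})"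

definition gq_with_regular_group ::
    "('a, 'c) monoid_scheme \<Rightarrow> nat \<Rightarrow> ('p, 'l) incidence_geometry \<Rightarrow> bool" where
  "gq_with_regular_group G s Q \<longleftrightarrow>
     generalized_quadrangle Q \<and> has_order Q s s \<and>
     (\<exists>\<phi> \<psi>. automorphism_group_via G Q \<phi> \<psi> \<and>
        acts_regularly G (points Q) \<phi> \<and> acts_regularly G (lines Q) \<psi>)"

definition AX1 :: "('a, 'c) monoid_scheme \<Rightarrow> nat \<Rightarrow> (nat \<Rightarrow> 'a) \<Rightarrow> 'a set \<Rightarrow> bool" where
  "AX1 G s g \<Sigma> \<longleftrightarrow>
     (\<forall>x \<in> carrier G - \<Sigma>. \<exists>!t. case t of (i, j, k) \<Rightarrow>
        i \<in> {0..s} \<and> j \<in> {0..s} \<and> k \<in> {0..s} \<and> i \<noteq> j \<and> k \<noteq> j \<and>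
        x = g i \<otimes>\<^bsub>G\<^esub> inv\<^bsub>G\<^esub> (g j) \<otimes>\<^bsub>G\<^esub> g k)"

definition AX2 :: "('a, 'c) monoid_scheme \<Rightarrow> nat \<Rightarrow> (nat \<Rightarrow> 'a) \<Rightarrow> 'a set \<Rightarrow> bool" where
  "AX2 G s g \<Sigma> \<longleftrightarrow>
     (\<forall>i\<in>{0..s}. \<forall>j\<in>{0..s}. \<forall>k\<in>{0..s}.
        g i \<otimes>\<^bsub>G\<^esub> inv\<^bsub>G\<^esub> (g j) \<otimes>\<^bsub>G\<^esub> g k \<in> \<Sigma> \<longrightarrow> i = j \<or> j = k)"

end

theory Submission
  imports Defs
begin

text \<open>A group that is regular on points and on lines lets both be labelled by group elements.
  Fix a line \<open>l\<close> and a point \<open>p\<close> on it, give the point \<open>g p\<close> and the line \<open>g l\<close> the label \<open>g\<close>, and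
  let \<open>D\<close> consist of the \<open>g\<close> for which \<open>g p\<close> lies on \<open>l\<close>. Since automorphisms preserve incidence,
  \<open>x p\<close> lies on \<open>y l\<close> exactly when \<open>y\<^sup>-\<^sup>1 x \<in> D\<close>. The geometry is therefore isomorphic to one built
  from \<open>G\<close> and \<open>D\<close> alone: its points are the elements of \<open>G\<close> and its lines are the left translates
  \<open>y D\<close>, labelled by \<open>y\<close>. Conversely \<open>G\<close> acts on the geometry built from any subset \<open>D\<close>, by left
  multiplication of the labels, regularly on points and on lines. So the theorem reduces to finding
  the subsets \<open>D\<close> whose geometry is a generalized quadrangle of order \<open>s\<close>.

  Each line carries \<open>card D\<close> points and each point lies on \<open>card D\<close> lines, so the order is \<open>s\<close> exactly
  when \<open>D\<close> has \<open>s + 1\<close> elements. Points \<open>x\<close> and \<open>r\<close> are collinear exactly when \<open>x = r b\<^sup>-\<^sup>1 c\<close> with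
  \<open>b, c \<in> D\<close>; the line joining them is then \<open>r b\<^sup>-\<^sup>1\<close>. By homogeneity only the base line \<open>D\<close> has to be
  examined. An element \<open>a b\<^sup>-\<^sup>1 c\<close> of \<open>D\<close> with \<open>a, b, c \<in> D\<close> is a point that the line \<open>a b\<^sup>-\<^sup>1\<close> has in
  common with \<open>D\<close>, and \<open>a\<close> is another one unless \<open>b = c\<close>; so (AX2) says that two distinct lines never share two points
  (\<open>digon_free_iff_unique_lines\<close>). For a point \<open>x \<notin> D\<close>, a factorization \<open>x = a b\<^sup>-\<^sup>1 c\<close> records a point
  \<open>a\<close> of \<open>D\<close> collinear with \<open>x\<close> together with the line that joins them. Granted (AX2), that line is
  determined by \<open>a\<close>, and so (AX1) is the axiom that exactly one point of \<open>D\<close> is collinear with \<open>x\<close>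
  (\<open>unique_factorization_iff_unique_projection\<close>).\<close>

section \<open>Isomorphic incidence geometries\<close>

definition geometry_iso ::
    "('p, 'l) incidence_geometry \<Rightarrow> ('q, 'm) incidence_geometry \<Rightarrow> ('p \<Rightarrow> 'q) \<Rightarrow> ('l \<Rightarrow> 'm) \<Rightarrow> bool" where
  "geometry_iso Q R \<sigma> \<tau> \<longleftrightarrow>
     bij_betw \<sigma> (points Q) (points R) \<and> bij_betw \<tau> (lines Q) (lines R) \<and>
     (\<forall>p\<in>points Q. \<forall>l\<in>lines Q. incid R (\<sigma> p) (\<tau> l) \<longleftrightarrow> incid Q p l)"

lemma ex1_bij_betw:
  assumes "bij_betw f A B"
  shows "(\<exists>!y. y \<in> B \<and> P y) \<longleftrightarrow> (\<exists>!x. x \<in> A \<and> P (f x))"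
proof -
  have inj: "\<And>x y. x \<in> A \<Longrightarrow> y \<in> A \<Longrightarrow> f x = f y \<Longrightarrow> x = y" and B: "B = f ` A"
    using assms by (auto simp: bij_betw_def inj_on_def)
  show ?thesis unfolding B
  proof
    assume "\<exists>!y. y \<in> f ` A \<and> P y"
    then obtain x where "x \<in> A" "P (f x)" "\<forall>y. y \<in> f ` A \<and> P y \<longrightarrow> y = f x" by blast
    then show "\<exists>!x. x \<in> A \<and> P (f x)" using inj by blast
  qed blast
qed

lemma collinear_geometry_iso:
  assumes "geometry_iso Q R \<sigma> \<tau>" "p \<in> points Q" "r \<in> points Q"
  shows "collinear R (\<sigma> p) (\<sigma> r) \<longleftrightarrow> collinear Q p r"
proof -
  have "lines R = \<tau> ` lines Q"
    using assms(1) by (auto simp: geometry_iso_def bij_betw_def)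
  then show ?thesis
    using assms by (auto simp: geometry_iso_def collinear_def)
qed

text \<open>Being a generalized quadrangle depends on the isomorphism class only. This is what allows an
  arbitrary quadrangle with a regular group to be replaced by a geometry on the group itself, and
  that geometry in turn by one on any type into which the group embeds.\<close>

lemma generalized_quadrangle_iso:
  assumes iso: "geometry_iso Q R \<sigma> \<tau>"
  shows "generalized_quadrangle R \<longleftrightarrow> generalized_quadrangle Q"
proof -
  have bij: "bij_betw \<sigma> (points Q) (points R)" "bij_betw \<tau> (lines Q) (lines R)"
    and incid: "\<And>p l. p \<in> points Q \<Longrightarrow> l \<in> lines Q \<Longrightarrow> incid R (\<sigma> p) (\<tau> l) \<longleftrightarrow> incid Q p l"
    using iso by (auto simp: geometry_iso_def)
  have P: "points R = \<sigma> ` points Q" and L: "lines R = \<tau> ` lines Q"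
    and inj: "inj_on \<sigma> (points Q)" "inj_on \<tau> (lines Q)"
    using bij by (auto simp: bij_betw_def)
  have eq: "\<sigma> p = \<sigma> r \<longleftrightarrow> p = r" if "p \<in> points Q" "r \<in> points Q" for p r
    using inj(1) that by (auto simp: inj_on_def)
  have eq': "\<tau> l = \<tau> m \<longleftrightarrow> l = m" if "l \<in> lines Q" "m \<in> lines Q" for l m
    using inj(2) that by (auto simp: inj_on_def)
  have proj: "(\<exists>!r. r \<in> points R \<and> incid R r (\<tau> l) \<and> collinear R (\<sigma> p) r) \<longleftrightarrow>
        (\<exists>!r. r \<in> points Q \<and> incid Q r l \<and> collinear Q p r)"
    if "p \<in> points Q" "l \<in> lines Q" for p l
  proof -
    have "(r \<in> points Q \<and> incid R (\<sigma> r) (\<tau> l) \<and> collinear R (\<sigma> p) (\<sigma> r)) \<longleftrightarrow>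
          (r \<in> points Q \<and> incid Q r l \<and> collinear Q p r)" for r
      using that incid collinear_geometry_iso[OF iso] by blast
    then show ?thesis by (simp only: ex1_bij_betw[OF bij(1)])
  qed
  have fin: "finite (points R) \<longleftrightarrow> finite (points Q)" "finite (lines R) \<longleftrightarrow> finite (lines Q)"
    using bij by (auto dest: bij_betw_finite)
  have pts: "(\<forall>p\<in>points R. A p) \<longleftrightarrow> (\<forall>p\<in>points Q. A (\<sigma> p))"
    and lns: "(\<forall>l\<in>lines R. B l) \<longleftrightarrow> (\<forall>l\<in>lines Q. B (\<tau> l))" for A B
    by (simp_all add: P L)
  show ?thesis
    unfolding generalized_quadrangle_def pts lns fin
    using eq eq' incid proj by (simp cong: ball_cong)
qed

lemma has_order_iso:
  assumes "geometry_iso Q R \<sigma> \<tau>"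
  shows "has_order R s t \<longleftrightarrow> has_order Q s t"
proof -
  have P: "points R = \<sigma> ` points Q" and L: "lines R = \<tau> ` lines Q"
    and inj: "inj_on \<sigma> (points Q)" "inj_on \<tau> (lines Q)"
    and incid: "\<And>p l. p \<in> points Q \<Longrightarrow> l \<in> lines Q \<Longrightarrow> incid R (\<sigma> p) (\<tau> l) \<longleftrightarrow> incid Q p l"
    using assms by (auto simp: geometry_iso_def bij_betw_def)
  have "card {p \<in> points R. incid R p (\<tau> l)} = card {p \<in> points Q. incid Q p l}"
    if "l \<in> lines Q" for l
  proof -
    have "{p \<in> points R. incid R p (\<tau> l)} = \<sigma> ` {p \<in> points Q. incid Q p l}"
      using that incid P by auto
    then show ?thesis by (simp add: card_image inj_on_subset[OF inj(1)])
  qed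
  moreover have "card {l \<in> lines R. incid R (\<sigma> p) l} = card {l \<in> lines Q. incid Q p l}"
    if "p \<in> points Q" for p
  proof -
    have "{l \<in> lines R. incid R (\<sigma> p) l} = \<tau> ` {l \<in> lines Q. incid Q p l}"
      using that incid L by auto
    then show ?thesis by (simp add: card_image inj_on_subset[OF inj(2)])
  qed
  ultimately show ?thesis
    unfolding has_order_def by (simp add: P L)
qed

section \<open>The geometry of left translates of a subset\<close>

text \<open>Both points and lines are group elements, the line \<open>y\<close> standing for the translate \<open>y D\<close>. Using
  \<open>y\<close> rather than the set \<open>y D\<close> keeps the action on lines regular even when \<open>y D = y' D\<close> for some
  \<open>y \<noteq> y'\<close>. Incidence depends on \<open>y\<^sup>-\<^sup>1 x\<close> only, which is unchanged when \<open>x\<close> and \<open>y\<close> are multiplied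
  by a common element on the left.\<close>

definition translate_geometry :: "('a, 'c) monoid_scheme \<Rightarrow> 'a set \<Rightarrow> ('a, 'a) incidence_geometry" where
  "translate_geometry G D = \<lparr>points = carrier G, lines = carrier G,
     incid = (\<lambda>x y. inv\<^bsub>G\<^esub> y \<otimes>\<^bsub>G\<^esub> x \<in> D)\<rparr>"

text \<open>The two conditions below are (AX1) and (AX2) with the indices replaced by the elements that they
  enumerate; a digon would be a pair of distinct lines through two common points.\<close>

definition unique_factorization :: "('a, 'c) monoid_scheme \<Rightarrow> 'a set \<Rightarrow> bool" where
  "unique_factorization G D \<longleftrightarrow>
     (\<forall>x\<in>carrier G - D. \<exists>!t. t \<in> D \<times> D \<times> D \<and> (case t of (a, b, c) \<Rightarrow>
        a \<noteq> b \<and> c \<noteq> b \<and> x = a \<otimes>\<^bsub>G\<^esub> inv\<^bsub>G\<^esub> b \<otimes>\<^bsub>G\<^esub> c))"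

definition digon_free :: "('a, 'c) monoid_scheme \<Rightarrow> 'a set \<Rightarrow> bool" where
  "digon_free G D \<longleftrightarrow>
     (\<forall>a\<in>D. \<forall>b\<in>D. \<forall>c\<in>D. a \<otimes>\<^bsub>G\<^esub> inv\<^bsub>G\<^esub> b \<otimes>\<^bsub>G\<^esub> c \<in> D \<longrightarrow> a = b \<or> b = c)"

lemma AX1_iff_unique_factorization:
  assumes "bij_betw g {0..s} D"
  shows "AX1 G s g D \<longleftrightarrow> unique_factorization G D"
proof -
  have bij: "bij_betw (map_prod g (map_prod g g))
      ({0..s} \<times> {0..s} \<times> {0..s}) (D \<times> D \<times> D)"
    using assms by (intro bij_betw_map_prod)
  have eq: "g i = g j \<longleftrightarrow> i = j" if "i \<in> {0..s}" "j \<in> {0..s}" for i j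
    using assms that by (auto simp: bij_betw_def inj_on_def)
  show ?thesis
    unfolding AX1_def unique_factorization_def ex1_bij_betw[OF bij]
    by (intro ball_cong refl arg_cong[where f = Ex1] ext) (use eq in auto)
qed

lemma AX2_iff_digon_free:
  assumes "bij_betw g {0..s} D"
  shows "AX2 G s g D \<longleftrightarrow> digon_free G D"
proof -
  have D: "D = g ` {0..s}" and eq: "\<And>i j. i \<in> {0..s} \<Longrightarrow> j \<in> {0..s} \<Longrightarrow> g i = g j \<longleftrightarrow> i = j"
    using assms by (auto simp: bij_betw_def inj_on_def)
  have "(\<forall>a\<in>D. A a) \<longleftrightarrow> (\<forall>i\<in>{0..s}. A (g i))" for A by (simp add: D)
  then show ?thesis
    unfolding AX2_def digon_free_def by (simp only:, intro ball_cong refl) (use eq in auto)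
qed

context group
begin

lemma inv_mult_cancel [simp]:
  assumes "x \<in> carrier G" "y \<in> carrier G"
  shows "inv x \<otimes> (x \<otimes> y) = y" "x \<otimes> (inv x \<otimes> y) = y"
  using assms by (simp_all flip: m_assoc)

lemma points_of_translate:
  assumes "D \<subseteq> carrier G" "y \<in> carrier G"
  shows "{x \<in> carrier G. inv y \<otimes> x \<in> D} = (\<lambda>d. y \<otimes> d) ` D"
proof -
  have "x \<in> (\<lambda>d. y \<otimes> d) ` D" if "x \<in> carrier G" "inv y \<otimes> x \<in> D" for x
    using that assms by (intro image_eqI[of _ _ "inv y \<otimes> x"]) auto
  moreover have "y \<otimes> d \<in> carrier G \<and> inv y \<otimes> (y \<otimes> d) \<in> D" if "d \<in> D" for d
    using that assms by (metis inv_mult_cancel(1) m_closed subsetD)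
  ultimately show ?thesis by blast
qed

lemma translates_through:
  assumes "D \<subseteq> carrier G" "x \<in> carrier G"
  shows "{y \<in> carrier G. inv y \<otimes> x \<in> D} = (\<lambda>d. x \<otimes> inv d) ` D"
proof -
  have "y \<in> (\<lambda>d. x \<otimes> inv d) ` D" if "y \<in> carrier G" "inv y \<otimes> x \<in> D" for y
    using that assms by (intro image_eqI[of _ _ "inv y \<otimes> x"]) (auto simp: inv_mult_group)
  moreover have "x \<otimes> inv d \<in> carrier G \<and> inv (x \<otimes> inv d) \<otimes> x \<in> D" if "d \<in> D" for d
  proof -
    have "d \<in> carrier G" using that assms(1) by blast
    then have "inv (x \<otimes> inv d) \<otimes> x = d"
      using assms(2) by (simp add: inv_mult_group m_assoc)
    then show ?thesis using that \<open>d \<in> carrier G\<close> assms(2) by simp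
  qed
  ultimately show ?thesis by blast
qed

text \<open>The points on the line \<open>y\<close> are the \<open>y d\<close> and the lines through the point \<open>x\<close> are the \<open>x d\<^sup>-\<^sup>1\<close>,
  with \<open>d\<close> ranging over \<open>D\<close> in both cases.\<close>

lemma has_order_translate_geometry:
  assumes "D \<subseteq> carrier G"
  shows "has_order (translate_geometry G D) s s \<longleftrightarrow> s > 0 \<and> card D = s + 1"
proof -
  have "card {x \<in> carrier G. inv y \<otimes> x \<in> D} = card D" if "y \<in> carrier G" for y
    unfolding points_of_translate[OF assms that]
    using that assms by (intro card_image inj_onI) (metis inv_mult_cancel(1) subsetD)
  moreover have "card {y \<in> carrier G. inv y \<otimes> x \<in> D} = card D" if "x \<in> carrier G" for x
    unfolding translates_through[OF assms that]
    using that assms by (intro card_image inj_onI) (metis inv_mult_cancel(1) inv_closed inv_inv subsetD)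
  ultimately show ?thesis
    unfolding has_order_def translate_geometry_def using one_closed by auto
qed

text \<open>If \<open>z\<close> is a line through \<open>x\<close> and \<open>r\<close>, then \<open>b = z\<^sup>-\<^sup>1 r\<close> and \<open>c = z\<^sup>-\<^sup>1 x\<close> belong to \<open>D\<close>; conversely
  \<open>z\<close> is recovered from \<open>b\<close> as \<open>r b\<^sup>-\<^sup>1\<close>.\<close>

lemma collinear_translate_geometry:
  assumes "D \<subseteq> carrier G" "x \<in> carrier G" "r \<in> carrier G"
  shows "collinear (translate_geometry G D) x r \<longleftrightarrow> (\<exists>b\<in>D. \<exists>c\<in>D. x = r \<otimes> inv b \<otimes> c)"
proof
  assume "collinear (translate_geometry G D) x r"
  then obtain z where z: "z \<in> carrier G" "inv z \<otimes> x \<in> D" "inv z \<otimes> r \<in> D"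
    by (auto simp: collinear_def translate_geometry_def)
  moreover have "x = r \<otimes> inv (inv z \<otimes> r) \<otimes> (inv z \<otimes> x)"
    using z(1) assms by (simp add: inv_mult_group m_assoc)
  ultimately show "\<exists>b\<in>D. \<exists>c\<in>D. x = r \<otimes> inv b \<otimes> c" by blast
next
  assume "\<exists>b\<in>D. \<exists>c\<in>D. x = r \<otimes> inv b \<otimes> c"
  then obtain b c where bc: "b \<in> D" "c \<in> D" and x: "x = r \<otimes> inv b \<otimes> c" by blast
  then have "b \<in> carrier G" "c \<in> carrier G" using assms(1) by auto
  then have "inv (r \<otimes> inv b) \<otimes> x = c" "inv (r \<otimes> inv b) \<otimes> r = b" "r \<otimes> inv b \<in> carrier G"
    using assms(3) by (simp_all add: x inv_mult_group m_assoc)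
  then show "collinear (translate_geometry G D) x r"
    using bc by (auto simp: collinear_def translate_geometry_def intro!: bexI[of _ "r \<otimes> inv b"])
qed

text \<open>Suppose that the lines \<open>y\<close> and \<open>z\<close> both contain \<open>x\<close> and \<open>r\<close>. Translated by \<open>y\<^sup>-\<^sup>1\<close>, this says that
  \<open>y\<^sup>-\<^sup>1 x\<close> and \<open>a = y\<^sup>-\<^sup>1 r\<close> are points of \<open>D\<close>, and with \<open>b = z\<^sup>-\<^sup>1 r\<close> and \<open>c = z\<^sup>-\<^sup>1 x\<close> the former equals
  \<open>a b\<^sup>-\<^sup>1 c\<close>. Here \<open>a = b\<close> means that the lines coincide and \<open>b = c\<close> that the points coincide.\<close>

lemma digon_free_iff_unique_lines:
  assumes "D \<subseteq> carrier G"
  shows "digon_free G D \<longleftrightarrow>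
    (\<forall>x\<in>carrier G. \<forall>r\<in>carrier G. x \<noteq> r \<longrightarrow> (\<forall>y\<in>carrier G. \<forall>z\<in>carrier G.
       inv y \<otimes> x \<in> D \<and> inv y \<otimes> r \<in> D \<and> inv z \<otimes> x \<in> D \<and> inv z \<otimes> r \<in> D \<longrightarrow> y = z))"
    (is "_ \<longleftrightarrow> ?unique")
proof
  assume tf: "digon_free G D"
  show ?unique
  proof (intro ballI impI, elim conjE)
    fix x r y z
    assume c: "x \<in> carrier G" "r \<in> carrier G" "y \<in> carrier G" "z \<in> carrier G" and "x \<noteq> r"
      and D: "inv y \<otimes> x \<in> D" "inv y \<otimes> r \<in> D" "inv z \<otimes> x \<in> D" "inv z \<otimes> r \<in> D"
    have "(inv y \<otimes> r) \<otimes> inv (inv z \<otimes> r) \<otimes> (inv z \<otimes> x) = inv y \<otimes> x"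
      using c by (simp add: inv_mult_group m_assoc)
    then have "inv y \<otimes> r = inv z \<otimes> r \<or> inv z \<otimes> r = inv z \<otimes> x"
      using tf D unfolding digon_free_def by metis
    then show "y = z"
      using c \<open>x \<noteq> r\<close> by (metis inv_closed inv_inv Units_eq Units_l_cancel right_cancel)
  qed
next
  assume unique: ?unique
  show "digon_free G D"
    unfolding digon_free_def
  proof (intro ballI impI)
    fix a b c assume D: "a \<in> D" "b \<in> D" "c \<in> D" and x: "a \<otimes> inv b \<otimes> c \<in> D"
    then have G: "a \<in> carrier G" "b \<in> carrier G" "c \<in> carrier G" using assms by auto
    \<comment> \<open>The lines \<open>\<one>\<close> and \<open>a b\<^sup>-\<^sup>1\<close> both contain the points \<open>a\<close> and \<open>a b\<^sup>-\<^sup>1 c\<close>.\<close>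
    have "inv (a \<otimes> inv b) \<otimes> (a \<otimes> inv b \<otimes> c) = c" "inv (a \<otimes> inv b) \<otimes> a = b"
      using G by (simp_all add: inv_mult_group m_assoc)
    then have "a \<otimes> inv b \<otimes> c = a \<or> \<one> = a \<otimes> inv b"
      using unique[rule_format, of "a \<otimes> inv b \<otimes> c" a \<one> "a \<otimes> inv b"] D x G by auto
    then show "a = b \<or> b = c"
    proof
      assume "a \<otimes> inv b \<otimes> c = a"
      then have "inv b \<otimes> c = \<one>" using G by (simp add: m_assoc)
      then have "b = c" using G by (metis inv_equality inv_inv inv_closed)
      then show ?thesis ..
    next
      assume "\<one> = a \<otimes> inv b"
      then have "a = b" using G by (metis inv_equality inv_inv inv_closed)
      then show ?thesis ..
    qed
  qed
qed

text \<open>Uniqueness of the whole triple follows from uniqueness of its first entry. Two factorizations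
  \<open>a b\<^sup>-\<^sup>1 c = a b'\<^sup>-\<^sup>1 c'\<close> give \<open>b' b\<^sup>-\<^sup>1 c = c' \<in> D\<close>, so that \<open>b' = b\<close> or \<open>b = c\<close> in the absence of digons,
  and \<open>b = c\<close> would give \<open>x = a \<in> D\<close>. As \<open>a = b\<close> would give \<open>x = c \<in> D\<close>, the inequalities \<open>a \<noteq> b\<close> and
  \<open>c \<noteq> b\<close> hold in every factorization of an element outside \<open>D\<close>.\<close>

lemma unique_factorization_iff_unique_projection:
  assumes D: "D \<subseteq> carrier G" and tf: "digon_free G D"
  shows "unique_factorization G D \<longleftrightarrow>
    (\<forall>x\<in>carrier G - D. \<exists>!a. a \<in> D \<and> (\<exists>b\<in>D. \<exists>c\<in>D. x = a \<otimes> inv b \<otimes> c))"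
  unfolding unique_factorization_def
proof (intro ball_cong refl)
  fix x assume x: "x \<in> carrier G - D"
  have distinct: "a \<noteq> b \<and> c \<noteq> b" if "a \<in> D" "b \<in> D" "c \<in> D" "x = a \<otimes> inv b \<otimes> c" for a b c
  proof -
    have "a \<in> carrier G" "b \<in> carrier G" "c \<in> carrier G" using that D by auto
    then show ?thesis using that x by (auto simp: m_assoc)
  qed
  have same: "b = b' \<and> c = c'"
    if mem: "a \<in> D" "b \<in> D" "c \<in> D" "b' \<in> D" "c' \<in> D"
      and eq: "x = a \<otimes> inv b \<otimes> c" "x = a \<otimes> inv b' \<otimes> c'" for a b c b' c'
  proof -
    have G: "a \<in> carrier G" "b \<in> carrier G" "c \<in> carrier G" "b' \<in> carrier G" "c' \<in> carrier G"
      using mem D by auto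
    have e: "inv b \<otimes> c = inv b' \<otimes> c'" using eq G by (simp add: m_assoc)
    then have "b' \<otimes> inv b \<otimes> c = c'"
      using G by (simp add: m_assoc)
    then have "b' = b" using tf mem distinct[OF mem(1-3) eq(1)] unfolding digon_free_def by metis
    with e G show ?thesis by simp
  qed
  let ?P = "\<lambda>t. t \<in> D \<times> D \<times> D \<and> (case t of (a, b, c) \<Rightarrow> a \<noteq> b \<and> c \<noteq> b \<and> x = a \<otimes> inv b \<otimes> c)"
  show "(\<exists>!t. ?P t) \<longleftrightarrow> (\<exists>!a. a \<in> D \<and> (\<exists>b\<in>D. \<exists>c\<in>D. x = a \<otimes> inv b \<otimes> c))" (is "?L \<longleftrightarrow> ?R")
  proof
    assume ?L
    then obtain t where t: "?P t" and u: "\<And>t'. ?P t' \<Longrightarrow> t' = t" by (elim ex1E) blast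
    obtain a b c where abc: "t = (a, b, c)" by (cases t)
    show ?R
    proof (rule ex1I[of _ a])
      show "a \<in> D \<and> (\<exists>b\<in>D. \<exists>c\<in>D. x = a \<otimes> inv b \<otimes> c)" using t abc by auto
      fix a' assume "a' \<in> D \<and> (\<exists>b\<in>D. \<exists>c\<in>D. x = a' \<otimes> inv b \<otimes> c)"
      then obtain b' c' where "a' \<in> D" "b' \<in> D" "c' \<in> D" "x = a' \<otimes> inv b' \<otimes> c'" by blast
      with distinct have "?P (a', b', c')" by auto
      with u abc show "a' = a" by blast
    qed
  next
    assume ?R
    then obtain a b c where abc: "a \<in> D" "b \<in> D" "c \<in> D" "x = a \<otimes> inv b \<otimes> c"
      and u: "\<And>a' b' c'. a' \<in> D \<Longrightarrow> b' \<in> D \<Longrightarrow> c' \<in> D \<Longrightarrow> x = a' \<otimes> inv b' \<otimes> c' \<Longrightarrow> a' = a"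
      by blast
    show ?L
    proof (rule ex1I[of _ "(a, b, c)"])
      show "?P (a, b, c)"
        using abc distinct by auto
      fix t assume "?P t"
      then obtain a' b' c' where t: "t = (a', b', c')" "a' \<in> D" "b' \<in> D" "c' \<in> D"
        "x = a' \<otimes> inv b' \<otimes> c'" by auto
      with u have "a' = a" by blast
      with t same[of a b c b' c'] abc show "t = (a, b, c)" by auto
    qed
  qed
qed

text \<open>(AX1) forces the group to be finite, as the axioms of a finite quadrangle demand: each element
  lies in \<open>D\<close> or is a value of \<open>a b\<^sup>-\<^sup>1 c\<close> on the finite set \<open>D \<times> D \<times> D\<close>.\<close>

lemma finite_carrier_of_unique_factorization:
  assumes "finite D" "unique_factorization G D"
  shows "finite (carrier G)"
proof (rule finite_subset)
  show "carrier G \<subseteq> D \<union> (\<lambda>(a, b, c). a \<otimes> inv b \<otimes> c) ` (D \<times> D \<times> D)"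
  proof
    fix x assume "x \<in> carrier G"
    then have "x \<in> D \<or> (\<exists>t. t \<in> D \<times> D \<times> D \<and> (case t of (a, b, c) \<Rightarrow>
        a \<noteq> b \<and> c \<noteq> b \<and> x = a \<otimes> inv b \<otimes> c))"
      using assms(2) unfolding unique_factorization_def by (blast dest: ex1_implies_ex)
    then show "x \<in> D \<union> (\<lambda>(a, b, c). a \<otimes> inv b \<otimes> c) ` (D \<times> D \<times> D)" by force
  qed
qed (use assms(1) in auto)

text \<open>Multiplication by \<open>y\<^sup>-\<^sup>1\<close> moves the line \<open>y\<close> to the base line \<open>D\<close> and the point \<open>x\<close> to \<open>y\<^sup>-\<^sup>1 x\<close>, so
  the projection axiom has to be understood for the base line only.\<close>

lemma unique_projection_translate:
  assumes D: "D \<subseteq> carrier G" and x: "x \<in> carrier G" and y: "y \<in> carrier G"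
  shows "(\<exists>!r. r \<in> carrier G \<and> inv y \<otimes> r \<in> D \<and> collinear (translate_geometry G D) x r) \<longleftrightarrow>
    (\<exists>!a. a \<in> D \<and> (\<exists>b\<in>D. \<exists>c\<in>D. inv y \<otimes> x = a \<otimes> inv b \<otimes> c))"
proof -
  have "bij_betw (\<lambda>a. y \<otimes> a) D {r \<in> carrier G. inv y \<otimes> r \<in> D}"
    unfolding points_of_translate[OF D y] bij_betw_def
    using y D by (auto simp: inj_on_def subset_iff)
  note ex1 = ex1_bij_betw[OF this]
  have "collinear (translate_geometry G D) x (y \<otimes> a) \<longleftrightarrow> (\<exists>b\<in>D. \<exists>c\<in>D. inv y \<otimes> x = a \<otimes> inv b \<otimes> c)"
    if "a \<in> D" for a
  proof -
    have a: "a \<in> carrier G" using that D by blast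
    have "x = y \<otimes> a \<otimes> inv b \<otimes> c \<longleftrightarrow> inv y \<otimes> x = a \<otimes> inv b \<otimes> c" if "b \<in> D" "c \<in> D" for b c
    proof -
      have "b \<in> carrier G" "c \<in> carrier G" using that D by auto
      then have "a \<otimes> inv b \<otimes> c \<in> carrier G" "y \<otimes> a \<otimes> inv b \<otimes> c = y \<otimes> (a \<otimes> inv b \<otimes> c)"
        using a y by (simp_all add: m_assoc)
      then show ?thesis using x y by (metis inv_mult_cancel)
    qed
    then show ?thesis
      unfolding collinear_translate_geometry[OF D x m_closed[OF y a]] by blast
  qed
  then have "(a \<in> D \<and> collinear (translate_geometry G D) x (y \<otimes> a)) \<longleftrightarrow>
      (a \<in> D \<and> (\<exists>b\<in>D. \<exists>c\<in>D. inv y \<otimes> x = a \<otimes> inv b \<otimes> c))" for a by blast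
  then show ?thesis
    using ex1[of "\<lambda>r. collinear (translate_geometry G D) x r"] by (simp add: conj_assoc)
qed

lemma generalized_quadrangle_translate_geometry:
  assumes D: "D \<subseteq> carrier G" and fin: "finite D"
  shows "generalized_quadrangle (translate_geometry G D) \<longleftrightarrow>
    unique_factorization G D \<and> digon_free G D"
proof -
  let ?proj = "\<lambda>x. \<exists>!a. a \<in> D \<and> (\<exists>b\<in>D. \<exists>c\<in>D. x = a \<otimes> inv b \<otimes> c)"
  have "generalized_quadrangle (translate_geometry G D) \<longleftrightarrow>
      finite (carrier G) \<and> digon_free G D \<and>
      (\<forall>x\<in>carrier G. \<forall>y\<in>carrier G. inv y \<otimes> x \<notin> D \<longrightarrow> ?proj (inv y \<otimes> x))"
    unfolding generalized_quadrangle_def digon_free_iff_unique_lines[OF D]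
    using unique_projection_translate[OF D]
    by (simp add: translate_geometry_def cong: ball_cong)
  also have "(\<forall>x\<in>carrier G. \<forall>y\<in>carrier G. inv y \<otimes> x \<notin> D \<longrightarrow> ?proj (inv y \<otimes> x))
      \<longleftrightarrow> (\<forall>x\<in>carrier G - D. ?proj x)" (is "?A \<longleftrightarrow> ?B")
  proof
    assume A: ?A
    show ?B
    proof
      fix x assume "x \<in> carrier G - D"
      then show "?proj x" using A[rule_format, of x \<one>] by simp
    qed
  qed (simp add: m_closed)
  finally show ?thesis
    using unique_factorization_iff_unique_projection[OF D]
      finite_carrier_of_unique_factorization[OF fin] by blast
qed

end

section \<open>Regular actions\<close>

lemma bij_betw_orbit_map_of_regular:
  assumes reg: "acts_regularly G E \<phi>" and x: "x \<in> E"
  shows "bij_betw (\<lambda>g. \<phi> g x) (carrier G) E"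
proof -
  interpret transitive_action G E \<phi> using reg by (simp add: acts_regularly_def)
  interpret group G using group_hom by (simp add: group_hom_def)
  have inj: "inj_on (\<lambda>g. \<phi> g x) (carrier G)"
  proof (rule inj_onI)
    fix g h assume gh: "g \<in> carrier G" "h \<in> carrier G" and eq: "\<phi> g x = \<phi> h x"
    have "\<phi> (inv\<^bsub>G\<^esub> h \<otimes>\<^bsub>G\<^esub> g) x = x"
      using gh x eq by (metis composition_rule orbit_sym_aux inv_closed)
    then have "inv\<^bsub>G\<^esub> h \<otimes>\<^bsub>G\<^esub> g \<in> stabilizer G \<phi> x"
      using gh by (simp add: stabilizer_def)
    then have "inv\<^bsub>G\<^esub> h \<otimes>\<^bsub>G\<^esub> g = \<one>\<^bsub>G\<^esub>"
      using reg x by (auto simp: acts_regularly_def)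
    then show "g = h" using gh by (metis inv_closed inv_equality inv_inv)
  qed
  have "(\<lambda>g. \<phi> g x) ` carrier G = E"
    using unique_orbit[OF x] element_image[OF _ x] by blast
  with inj show ?thesis by (simp add: bij_betw_def)
qed

text \<open>The orbit maps of a base point and a base line label the points and the lines by group elements.
  Applying \<open>y\<^sup>-\<^sup>1\<close> to the point \<open>x p\<close> and the line \<open>y l\<close> shows that their incidence is decided on the
  base line.\<close>

lemma geometry_iso_translate_geometry:
  assumes aut: "automorphism_group_via G Q \<phi> \<psi>"
    and reg: "acts_regularly G (points Q) \<phi>" "acts_regularly G (lines Q) \<psi>"
    and p: "p \<in> points Q" and l: "l \<in> lines Q"
  shows "geometry_iso (translate_geometry G {g \<in> carrier G. incid Q (\<phi> g p) l}) Q
           (\<lambda>g. \<phi> g p) (\<lambda>g. \<psi> g l)"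
proof -
  interpret P: group_action G "points Q" \<phi> using aut by (simp add: automorphism_group_via_def)
  interpret L: group_action G "lines Q" \<psi> using aut by (simp add: automorphism_group_via_def)
  interpret group G using P.group_hom by (simp add: group_hom_def)
  have "incid Q (\<phi> x p) (\<psi> y l) \<longleftrightarrow> incid Q (\<phi> (inv\<^bsub>G\<^esub> y \<otimes>\<^bsub>G\<^esub> x) p) l"
    if "x \<in> carrier G" "y \<in> carrier G" for x y
  proof -
    have "\<phi> (inv\<^bsub>G\<^esub> y) (\<phi> x p) = \<phi> (inv\<^bsub>G\<^esub> y \<otimes>\<^bsub>G\<^esub> x) p" "\<psi> (inv\<^bsub>G\<^esub> y) (\<psi> y l) = l"
      using that p l by (simp_all add: P.composition_rule L.orbit_sym_aux)
    moreover have "automorphism Q (\<phi> (inv\<^bsub>G\<^esub> y)) (\<psi> (inv\<^bsub>G\<^esub> y))"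
      using aut that by (simp add: automorphism_group_via_def)
    moreover have "\<phi> x p \<in> points Q" "\<psi> y l \<in> lines Q"
      using that p l P.element_image L.element_image by blast+
    ultimately show ?thesis unfolding automorphism_def by metis
  qed
  then show ?thesis
    using bij_betw_orbit_map_of_regular[OF reg(1) p] bij_betw_orbit_map_of_regular[OF reg(2) l]
    by (simp add: geometry_iso_def translate_geometry_def)
qed

text \<open>Left multiplication by \<open>g\<close>, transported along an injection \<open>e\<close> of the group into another type.
  The restriction makes it extensional, as elements of \<^const>\<open>BijGroup\<close> have to be.\<close>

definition transported_translation ::
    "('a, 'c) monoid_scheme \<Rightarrow> ('a \<Rightarrow> 'b) \<Rightarrow> 'a \<Rightarrow> 'b \<Rightarrow> 'b" where
  "transported_translation G e g =
     restrict (\<lambda>u. e (g \<otimes>\<^bsub>G\<^esub> inv_into (carrier G) e u)) (e ` carrier G)"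

context group
begin

lemma transported_translation_apply [simp]:
  assumes "inj_on e (carrier G)" "x \<in> carrier G"
  shows "transported_translation G e g (e x) = e (g \<otimes> x)"
  using assms by (simp add: transported_translation_def)

lemma bij_transported_translation:
  assumes e: "inj_on e (carrier G)" and g: "g \<in> carrier G"
  shows "bij_betw (transported_translation G e g) (e ` carrier G) (e ` carrier G)"
  by (rule bij_betw_byWitness[where f' = "transported_translation G e (inv g)"])
     (use assms in auto)

lemma group_action_transported_translation:
  assumes e: "inj_on e (carrier G)"
  shows "group_action G (e ` carrier G) (transported_translation G e)"
proof -
  let ?\<phi> = "transported_translation G e"
  have Bij: "?\<phi> g \<in> Bij (e ` carrier G)" if "g \<in> carrier G" for g
    using bij_transported_translation[OF e that]
    by (simp add: Bij_def transported_translation_def)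
  have "?\<phi> (g \<otimes> h) = compose (e ` carrier G) (?\<phi> g) (?\<phi> h)"
    if "g \<in> carrier G" "h \<in> carrier G" for g h
  proof (rule extensionalityI[of _ "e ` carrier G"])
    fix u assume "u \<in> e ` carrier G"
    then show "?\<phi> (g \<otimes> h) u = compose (e ` carrier G) (?\<phi> g) (?\<phi> h) u"
      using e that by (auto simp: compose_def m_assoc)
  qed (simp_all add: transported_translation_def)
  then show ?thesis
    unfolding group_action_def group_hom_def group_hom_axioms_def
    using Bij by (intro conjI is_group group_BijGroup homI) (simp_all add: BijGroup_def)
qed

lemma regular_transported_translation:
  assumes e: "inj_on e (carrier G)"
  shows "acts_regularly G (e ` carrier G) (transported_translation G e)"
proof -
  interpret group_action G "e ` carrier G" "transported_translation G e"
    by (rule group_action_transported_translation[OF e])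
  have "\<exists>g\<in>carrier G. transported_translation G e g (e x) = e y"
    if "x \<in> carrier G" "y \<in> carrier G" for x y
    using that e by (intro bexI[of _ "y \<otimes> inv x"]) (simp_all add: m_assoc)
  then have "transitive_action G (e ` carrier G) (transported_translation G e)"
    by unfold_locales auto
  moreover have "stabilizer G (transported_translation G e) (e x) = {\<one>}" if "x \<in> carrier G" for x
    using that e by (auto simp: stabilizer_def inj_on_eq_iff)
  ultimately show ?thesis
    using one_closed by (auto simp: acts_regularly_def)
qed

text \<open>Transport along \<open>e\<close> yields a quadrangle in a prescribed type. One map serves as the action on
  points and on lines, because both are copies of the group.\<close>

lemma gq_with_regular_group_of_translate_geometry:
  fixes e :: "'a \<Rightarrow> 'p"
  assumes e: "inj_on e (carrier G)"
    and gq: "generalized_quadrangle (translate_geometry G D)"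
    and ord: "has_order (translate_geometry G D) s s"
  shows "\<exists>Q :: ('p, 'p) incidence_geometry. gq_with_regular_group G s Q"
proof -
  let ?d = "inv_into (carrier G) e"
  let ?\<phi> = "transported_translation G e"
  define Q where "Q = \<lparr>points = e ` carrier G, lines = e ` carrier G,
    incid = (\<lambda>u v. inv (?d v) \<otimes> ?d u \<in> D)\<rparr>"
  have iso: "geometry_iso (translate_geometry G D) Q e e"
    using e by (simp add: geometry_iso_def translate_geometry_def Q_def bij_betw_def)
  have aut: "automorphism Q (?\<phi> g) (?\<phi> g)" if "g \<in> carrier G" for g
  proof -
    have "inv (g \<otimes> y) \<otimes> (g \<otimes> x) = inv y \<otimes> x" if "x \<in> carrier G" "y \<in> carrier G" for x y
      using that \<open>g \<in> carrier G\<close> by (simp add: inv_mult_group m_assoc)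
    then show ?thesis
      using bij_transported_translation[OF e that] e that
      by (simp add: automorphism_def Q_def)
  qed
  have "inj_on (\<lambda>g. (?\<phi> g, ?\<phi> g)) (carrier G)"
  proof (rule inj_onI)
    fix g h assume gh: "g \<in> carrier G" "h \<in> carrier G" and "(?\<phi> g, ?\<phi> g) = (?\<phi> h, ?\<phi> h)"
    then have "?\<phi> g (e \<one>) = ?\<phi> h (e \<one>)" by simp
    then show "g = h" using gh e by (simp add: inj_on_eq_iff)
  qed
  then have "automorphism_group_via G Q ?\<phi> ?\<phi>"
    using aut group_action_transported_translation[OF e]
    by (simp add: automorphism_group_via_def Q_def)
  then have "gq_with_regular_group G s Q"
    unfolding gq_with_regular_group_def
    using gq ord generalized_quadrangle_iso[OF iso] has_order_iso[OF iso]
      regular_transported_translation[OF e] by (auto simp: Q_def)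
  then show ?thesis ..
qed

end

section \<open>The characterization\<close>

lemma ex_bij_betw_atMost_mapping_0:
  assumes "finite D" "card D = s + 1" "d \<in> D"
  shows "\<exists>g. bij_betw g {0..s} D \<and> g 0 = d"
proof -
  have "card {1..s} = card (D - {d})" using assms by simp
  then obtain h where "bij_betw h {1..s} (D - {d})"
    using assms(1) by (meson bij_betw_iff_card finite_Diff finite_atLeastAtMost)
  then have "bij_betw (h(0 := d)) {1..s} (D - {d})"
    by (rule bij_betw_cong[THEN iffD1, rotated]) auto
  then have "bij_betw (h(0 := d)) ({1..s} \<union> {0}) ((D - {d}) \<union> {d})"
    by (rule bij_betw_combine) (auto simp: bij_betw_def)
  moreover have "{1..s} \<union> {0} = {0..s}" "(D - {d}) \<union> {d} = D" using assms(3) by auto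
  ultimately show ?thesis by (intro exI[of _ "h(0 := d)"]) simp
qed

text \<open>The base point has to be chosen on the base line: this puts \<open>\<one>\<close> into the set \<open>D\<close> of labels of the
  points of that line, as the normalization \<open>g 0 = \<one>\<close> requires.\<close>

lemma (in group) AX_of_gq_with_regular_group:
  assumes "gq_with_regular_group G s Q"
  shows "\<exists>D g. D \<subseteq> carrier G \<and> bij_betw g {0..s} D \<and> g 0 = \<one> \<and> AX1 G s g D \<and> AX2 G s g D"
proof -
  from assms obtain \<phi> \<psi> where gq: "generalized_quadrangle Q" and ord: "has_order Q s s"
    and aut: "automorphism_group_via G Q \<phi> \<psi>"
    and reg: "acts_regularly G (points Q) \<phi>" "acts_regularly G (lines Q) \<psi>"
    unfolding gq_with_regular_group_def by blast
  from reg(2) obtain l where l: "l \<in> lines Q" by (auto simp: acts_regularly_def)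
  with ord have "card {p \<in> points Q. incid Q p l} = s + 1" by (simp add: has_order_def)
  then have "{p \<in> points Q. incid Q p l} \<noteq> {}" by force
  then obtain p where p: "p \<in> points Q" and pl: "incid Q p l" by blast
  define D where "D = {g \<in> carrier G. incid Q (\<phi> g p) l}"
  interpret P: group_action G "points Q" \<phi> using aut by (simp add: automorphism_group_via_def)
  have "\<phi> \<one> p = p" using p by (metis P.id_eq_one restrict_apply')
  then have one: "\<one> \<in> D" using pl by (simp add: D_def)
  have D: "D \<subseteq> carrier G" by (auto simp: D_def)
  have iso: "geometry_iso (translate_geometry G D) Q (\<lambda>g. \<phi> g p) (\<lambda>g. \<psi> g l)"
    unfolding D_def by (rule geometry_iso_translate_geometry[OF aut reg p l])
  have card: "card D = s + 1"
    using ord has_order_iso[OF iso] has_order_translate_geometry[OF D] by simp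
  then have fin: "finite D" by (intro card_ge_0_finite) simp
  obtain g where g: "bij_betw g {0..s} D" "g 0 = \<one>"
    using ex_bij_betw_atMost_mapping_0[OF fin card one] by blast
  have "unique_factorization G D \<and> digon_free G D"
    using gq generalized_quadrangle_iso[OF iso] generalized_quadrangle_translate_geometry[OF D fin]
    by simp
  then show ?thesis
    using D g AX1_iff_unique_factorization[OF g(1)] AX2_iff_digon_free[OF g(1)] by blast
qed

lemma (in group) gq_with_regular_group_of_AX:
  assumes "s > 0" and D: "D \<subseteq> carrier G" and g: "bij_betw g {0..s} D"
    and AX: "AX1 G s g D" "AX2 G s g D"
  shows "\<exists>Q :: (nat, nat) incidence_geometry. gq_with_regular_group G s Q"
proof -
  have fin: "finite D" using g bij_betw_finite by blast
  have uf: "unique_factorization G D" "digon_free G D"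
    using AX AX1_iff_unique_factorization[where G = G, OF g] AX2_iff_digon_free[where G = G, OF g] by simp_all
  obtain e :: "'a \<Rightarrow> nat" where "inj_on e (carrier G)"
    using finite_carrier_of_unique_factorization[OF fin uf(1)] finite_imp_inj_to_nat_seg by blast
  moreover have "generalized_quadrangle (translate_geometry G D)"
    using uf generalized_quadrangle_translate_geometry[OF D fin] by simp
  moreover have "has_order (translate_geometry G D) s s"
    using \<open>s > 0\<close> bij_betw_same_card[OF g] has_order_translate_geometry[OF D] by simp
  ultimately show ?thesis by (rule gq_with_regular_group_of_translate_geometry)
qed

(* HOL cannot quantify existentially over types. Generalized quadrangles are finite, so one
   may look for one with natural numbers as points and lines; the second conjunct, for
   arbitrary types 'p and 'l, states that this loses nothing. *)
theorem theorem1p1: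
  fixes G :: "('a, 'c) monoid_scheme" (structure) and s :: nat
  assumes "group G" and "s > 0"
  shows "((\<exists>Q :: (nat, nat) incidence_geometry. gq_with_regular_group G s Q) \<longleftrightarrow>
          (\<exists>\<Sigma> g. \<Sigma> \<subseteq> carrier G \<and> bij_betw g {0..s} \<Sigma> \<and> g 0 = \<one> \<and>
                 AX1 G s g \<Sigma> \<and> AX2 G s g \<Sigma>)) \<and>
         ((\<exists>Q :: ('p, 'l) incidence_geometry. gq_with_regular_group G s Q) \<longrightarrow>
          (\<exists>Q :: (nat, nat) incidence_geometry. gq_with_regular_group G s Q))"
proof -
  note nec = group.AX_of_gq_with_regular_group[OF assms(1)]
  note suf = group.gq_with_regular_group_of_AX[OF assms]
  show ?thesis
  proof (intro conjI iffI impI; elim exE conjE)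
    fix Q :: "(nat, nat) incidence_geometry"
    assume "gq_with_regular_group G s Q"
    then show "\<exists>\<Sigma> g. \<Sigma> \<subseteq> carrier G \<and> bij_betw g {0..s} \<Sigma> \<and> g 0 = \<one> \<and>
        AX1 G s g \<Sigma> \<and> AX2 G s g \<Sigma>"
      by (rule nec)
  next
    fix \<Sigma> g
    assume "\<Sigma> \<subseteq> carrier G" "bij_betw g {0..s} \<Sigma>" "AX1 G s g \<Sigma>" "AX2 G s g \<Sigma>"
    then show "\<exists>Q :: (nat, nat) incidence_geometry. gq_with_regular_group G s Q"
      by (rule suf)
  next
    fix Q :: "('p, 'l) incidence_geometry"
    assume "gq_with_regular_group G s Q"
    then obtain \<Sigma> g where "\<Sigma> \<subseteq> carrier G" "bij_betw g {0..s} \<Sigma>" "AX1 G s g \<Sigma>" "AX2 G s g \<Sigma>"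
      using nec by blast
    then show "\<exists>Q :: (nat, nat) incidence_geometry. gq_with_regular_group G s Q"
      by (rule suf)
  qed
qed

end
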